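(* Let $(X,d)$ be a metric space, let $\mathcal B$ be a bornology on $X$, let $\mathcal I$ be a $\mathcal G$-admissible ideal of a directed set $(\mathcal G,\geq)$, let $\{D_\gamma\}_{\gamma\in\mathcal G}$ be a net of non-empty subsets of $X$ and let $D$ be a non-empty subset of $X$. If $\{D_\gamma\}_{\gamma\in\mathcal G}$ is $\mathcal B_{\mathcal I^*}$-convergent to $D$, then $\{D_\gamma\}_{\gamma\in\mathcal G}$ is bornological $\mathcal I$-convergent ($\mathcal B_{\mathcal I}$-convergent) to $D$.
   Context: A bornology on $X$ is a family $\mathcal B$ of non-empty subsets of $X$ that covers $X$, is closed under finite unions, and contains every non-empty subset of each of its members. For $G\subset X$ and $\epsilon>0$, $G^\epsilon=\bigcup_{x\in G}\{y: d(x,y)<\epsilon\}$. An ideal of a set $\mathcal G$ is a family $\mathcal I\subset 2^{\mathcal G}$ containing $\emptyset$, closed under finite unions and under taking subsets; it is non-trivial if $\mathcal I\neq\{\emptyset\}$ and $\mathcal G\notin\mathcal I$. For a non-trivial ideal, $\mathcal F(\mathcal I)=\{A\subset\mathcal G:\mathcal G\setminus A\in\mathcal I\}$ is the associated filter. For a directed set $(\mathcal G,\geq)$ and $\gamma\in\mathcal G$ put $\mathcal M_\gamma=\{\alpha\in\mathcal G:\alpha\geq\gamma\}$. A non-trivial ideal $\mathcal I$ of $\mathcal G$ is $\mathcal G$-admissible if $\mathcal M_\gamma\in\mathcal F(\mathcal I)$ for all $\gamma\in\mathcal G$. A net $\{D_\gamma\}_{\gamma\in\mathcal G'}$ of non-empty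 subsets of $X$ over a directed set $\mathcal G'$ is $\mathcal B$-convergent to $D$ if for every $B\in\mathcal B$ and $\epsilon>0$ there is $\gamma_0\in\mathcal G'$ such that $D\cap B\subset D_\gamma^\epsilon$ and $D_\gamma\cap B\subset D^\epsilon$ for all $\gamma\in\mathcal G'$ with $\gamma\geq\gamma_0$. The net $\{D_\gamma\}_{\gamma\in\mathcal G}$ is bornological $\mathcal I$-convergent ($\mathcal B_{\mathcal I}$-convergent) to $D$ if for every $B\in\mathcal B$ and $\epsilon>0$ both $\{\gamma\in\mathcal G: D\cap B\subset D_\gamma^\epsilon\}\in\mathcal F(\mathcal I)$ and $\{\gamma\in\mathcal G: D_\gamma\cap B\subset D^\epsilon\}\in\mathcal F(\mathcal I)$. The net $\{D_\gamma\}_{\gamma\in\mathcal G}$ is $\mathcal B_{\mathcal I^*}$-convergent to $D$ if there is a set $\mathcal G'\in\mathcal F(\mathcal I)$ such that $\mathcal G'$ is itself a directed set with respect to the relation induced from $(\mathcal G,\geq)$ and the net $\{D_\gamma\}_{\gamma\in\mathcal G'}$ is $\mathcal B$-convergent to $D$. *)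

theory Defs
  imports "HOL-Analysis.Abstract_Metric_Spaces"
begin

definition bornology :: "'a set \<Rightarrow> 'a set set \<Rightarrow> bool" where
  "bornology X \<B> \<longleftrightarrow>
     (\<forall>B\<in>\<B>. B \<noteq> {} \<and> B \<subseteq> X) \<and>
     \<Union>\<B> = X \<and>
     (\<forall>B\<in>\<B>. \<forall>C\<in>\<B>. B \<union> C \<in> \<B>) \<and>
     (\<forall>B\<in>\<B>. \<forall>C. C \<noteq> {} \<and> C \<subseteq> B \<longrightarrow> C \<in> \<B>)"

definition enlargement :: "'a set \<Rightarrow> ('a \<Rightarrow> 'a \<Rightarrow> real) \<Rightarrow> 'a set \<Rightarrow> real \<Rightarrow> 'a set" where
  "enlargement X d G \<epsilon> = (\<Union>x\<in>G. Metric_space.mball X d x \<epsilon>)"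

text \<open>Directed sets are given by a carrier and a relation, where \<open>ge \<alpha> \<gamma>\<close>
  stands for \<open>\<alpha> \<ge> \<gamma>\<close>; antisymmetry is not required.\<close>

definition directed_set :: "'g set \<Rightarrow> ('g \<Rightarrow> 'g \<Rightarrow> bool) \<Rightarrow> bool" where
  "directed_set \<G> ge \<longleftrightarrow>
     \<G> \<noteq> {} \<and> reflp_on \<G> ge \<and> transp_on \<G> ge \<and>
     (\<forall>\<alpha>\<in>\<G>. \<forall>\<beta>\<in>\<G>. \<exists>\<gamma>\<in>\<G>. ge \<gamma> \<alpha> \<and> ge \<gamma> \<beta>)"

definition ideal_on :: "'g set \<Rightarrow> 'g set set \<Rightarrow> bool" where
  "ideal_on \<G> \<I> \<longleftrightarrow>
     \<I> \<subseteq> Pow \<G> \<and> {} \<in> \<I> \<and>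
     (\<forall>A\<in>\<I>. \<forall>B\<in>\<I>. A \<union> B \<in> \<I>) \<and>
     (\<forall>A\<in>\<I>. \<forall>B. B \<subseteq> A \<longrightarrow> B \<in> \<I>)"

definition nontrivial_ideal_on :: "'g set \<Rightarrow> 'g set set \<Rightarrow> bool" where
  "nontrivial_ideal_on \<G> \<I> \<longleftrightarrow> ideal_on \<G> \<I> \<and> \<I> \<noteq> {{}} \<and> \<G> \<notin> \<I>"

definition ideal_filter :: "'g set \<Rightarrow> 'g set set \<Rightarrow> 'g set set" where
  "ideal_filter \<G> \<I> = {A. A \<subseteq> \<G> \<and> \<G> - A \<in> \<I>}"

definition tail :: "'g set \<Rightarrow> ('g \<Rightarrow> 'g \<Rightarrow> bool) \<Rightarrow> 'g \<Rightarrow> 'g set" where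
  "tail \<G> ge \<gamma> = {\<alpha>\<in>\<G>. ge \<alpha> \<gamma>}"

definition admissible_ideal :: "'g set \<Rightarrow> ('g \<Rightarrow> 'g \<Rightarrow> bool) \<Rightarrow> 'g set set \<Rightarrow> bool" where
  "admissible_ideal \<G> ge \<I> \<longleftrightarrow>
     nontrivial_ideal_on \<G> \<I> \<and> (\<forall>\<gamma>\<in>\<G>. tail \<G> ge \<gamma> \<in> ideal_filter \<G> \<I>)"

definition B_convergent ::
  "'a set \<Rightarrow> ('a \<Rightarrow> 'a \<Rightarrow> real) \<Rightarrow> 'a set set \<Rightarrow> 'g set \<Rightarrow> ('g \<Rightarrow> 'g \<Rightarrow> bool)
     \<Rightarrow> ('g \<Rightarrow> 'a set) \<Rightarrow> 'a set \<Rightarrow> bool" where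
  "B_convergent X d \<B> \<G> ge S D \<longleftrightarrow>
     (\<forall>B\<in>\<B>. \<forall>\<epsilon>>0. \<exists>\<gamma>\<^sub>0\<in>\<G>. \<forall>\<gamma>\<in>\<G>. ge \<gamma> \<gamma>\<^sub>0 \<longrightarrow>
        D \<inter> B \<subseteq> enlargement X d (S \<gamma>) \<epsilon> \<and> S \<gamma> \<inter> B \<subseteq> enlargement X d D \<epsilon>)"

definition B_I_convergent ::
  "'a set \<Rightarrow> ('a \<Rightarrow> 'a \<Rightarrow> real) \<Rightarrow> 'a set set \<Rightarrow> 'g set \<Rightarrow> 'g set set
     \<Rightarrow> ('g \<Rightarrow> 'a set) \<Rightarrow> 'a set \<Rightarrow> bool" where
  "B_I_convergent X d \<B> \<G> \<I> S D \<longleftrightarrow>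
     (\<forall>B\<in>\<B>. \<forall>\<epsilon>>0.
        {\<gamma>\<in>\<G>. D \<inter> B \<subseteq> enlargement X d (S \<gamma>) \<epsilon>} \<in> ideal_filter \<G> \<I> \<and>
        {\<gamma>\<in>\<G>. S \<gamma> \<inter> B \<subseteq> enlargement X d D \<epsilon>} \<in> ideal_filter \<G> \<I>)"

definition B_Istar_convergent ::
  "'a set \<Rightarrow> ('a \<Rightarrow> 'a \<Rightarrow> real) \<Rightarrow> 'a set set \<Rightarrow> 'g set \<Rightarrow> ('g \<Rightarrow> 'g \<Rightarrow> bool)
     \<Rightarrow> 'g set set \<Rightarrow> ('g \<Rightarrow> 'a set) \<Rightarrow> 'a set \<Rightarrow> bool" where
  "B_Istar_convergent X d \<B> \<G> ge \<I> S D \<longleftrightarrow>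
     (\<exists>\<G>'\<in>ideal_filter \<G> \<I>. directed_set \<G>' ge \<and> B_convergent X d \<B> \<G>' ge S D)"

end

theory Submission
  imports Defs
begin

text \<open>Let \<open>\<G>'\<close> be the member of the filter along which the net is
  \<B>-convergent. For fixed \<open>B\<close> and \<open>\<epsilon>\<close>, both inclusions hold at
  every index of \<open>\<G>'\<close> beyond some threshold \<open>\<gamma>\<^sub>0\<close>.
  Admissibility puts the tail of \<open>\<G>\<close> at \<open>\<gamma>\<^sub>0\<close> in the
  filter, so its intersection with \<open>\<G>'\<close> is in the filter as well
  (\<open>ideal_filter_Int\<close>). Each of the two index sets to be found large contains this
  intersection, hence belongs to the filter by upward closure
  (\<open>ideal_filter_mono\<close>).\<close>

lemma ideal_filter_mono:
  assumes "ideal_on \<G> \<I>" and "A \<in> ideal_filter \<G> \<I>" and "A \<subseteq> C" and "C \<subseteq> \<G>"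
  shows "C \<in> ideal_filter \<G> \<I>"
proof -
  have "\<G> - A \<in> \<I>" and "\<G> - C \<subseteq> \<G> - A"
    using assms by (auto simp: ideal_filter_def)
  then have "\<G> - C \<in> \<I>"
    using assms(1) unfolding ideal_on_def by blast
  then show ?thesis
    using assms(4) by (simp add: ideal_filter_def)
qed

lemma ideal_filter_Int:
  assumes "ideal_on \<G> \<I>" and "A \<in> ideal_filter \<G> \<I>" and "C \<in> ideal_filter \<G> \<I>"
  shows "A \<inter> C \<in> ideal_filter \<G> \<I>"
  using assms by (auto simp: ideal_filter_def ideal_on_def Diff_Int)

theorem theorem4p1:
  fixes X :: "'a set" and d :: "'a \<Rightarrow> 'a \<Rightarrow> real" and \<B> :: "'a set set"
    and \<G> :: "'g set" and ge :: "'g \<Rightarrow> 'g \<Rightarrow> bool" and \<I> :: "'g set set"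
    and S :: "'g \<Rightarrow> 'a set" and D :: "'a set"
  assumes "Metric_space X d"
    and "bornology X \<B>"
    and "directed_set \<G> ge"
    and "admissible_ideal \<G> ge \<I>"
    and "\<And>\<gamma>. \<gamma> \<in> \<G> \<Longrightarrow> S \<gamma> \<noteq> {} \<and> S \<gamma> \<subseteq> X"
    and "D \<noteq> {}" and "D \<subseteq> X"
    and "B_Istar_convergent X d \<B> \<G> ge \<I> S D"
  shows "B_I_convergent X d \<B> \<G> \<I> S D"
proof -
  have I: "ideal_on \<G> \<I>"
    using assms(4) by (simp add: admissible_ideal_def nontrivial_ideal_on_def)
  obtain \<G>' where G': "\<G>' \<in> ideal_filter \<G> \<I>" and conv: "B_convergent X d \<B> \<G>' ge S D"
    using assms(8) by (auto simp: B_Istar_convergent_def)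
  show ?thesis
    unfolding B_I_convergent_def
  proof (intro ballI allI impI)
    fix B \<epsilon> assume "B \<in> \<B>" and "\<epsilon> > (0::real)"
    then obtain \<gamma>\<^sub>0 where "\<gamma>\<^sub>0 \<in> \<G>'" and close: "\<And>\<gamma>. \<gamma> \<in> \<G>' \<Longrightarrow> ge \<gamma> \<gamma>\<^sub>0 \<Longrightarrow>
        D \<inter> B \<subseteq> enlargement X d (S \<gamma>) \<epsilon> \<and> S \<gamma> \<inter> B \<subseteq> enlargement X d D \<epsilon>"
      using conv unfolding B_convergent_def by meson
    \<comment> \<open>Admissibility speaks of tails of the full index set, so the threshold found in
      \<open>\<G>'\<close> is regarded as an element of \<open>\<G>\<close>.\<close>
    then have "\<gamma>\<^sub>0 \<in> \<G>"
      using G' by (auto simp: ideal_filter_def)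
    then have "tail \<G> ge \<gamma>\<^sub>0 \<in> ideal_filter \<G> \<I>"
      using assms(4) by (simp add: admissible_ideal_def)
    then have F: "\<G>' \<inter> tail \<G> ge \<gamma>\<^sub>0 \<in> ideal_filter \<G> \<I>"
      by (rule ideal_filter_Int[OF I G'])
    \<comment> \<open>The tail is taken in \<open>\<G>\<close> and may leave \<open>\<G>'\<close>,
      where \<open>close\<close> gives no information; this is why it is cut down to
      \<open>\<G>'\<close>.\<close>
    have "\<G>' \<inter> tail \<G> ge \<gamma>\<^sub>0 \<subseteq> {\<gamma>\<in>\<G>. D \<inter> B \<subseteq> enlargement X d (S \<gamma>) \<epsilon>}"
      and "\<G>' \<inter> tail \<G> ge \<gamma>\<^sub>0 \<subseteq> {\<gamma>\<in>\<G>. S \<gamma> \<inter> B \<subseteq> enlargement X d D \<epsilon>}"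
      using close by (auto simp: tail_def)
    then show "{\<gamma>\<in>\<G>. D \<inter> B \<subseteq> enlargement X d (S \<gamma>) \<epsilon>} \<in> ideal_filter \<G> \<I> \<and>
        {\<gamma>\<in>\<G>. S \<gamma> \<inter> B \<subseteq> enlargement X d D \<epsilon>} \<in> ideal_filter \<G> \<I>"
      \<comment> \<open>The single filter member from \<open>F\<close> lies below both index sets,
        so upward closure settles the two conjuncts at once.\<close>
      by (auto intro: ideal_filter_mono[OF I F])
  qed
qed

end
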